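(* Let $p,q\ge1$ be integers, $n=p+q$, and let $\mathbf S$ be the spin module attached to the Levi subalgebra $\mathfrak h=\mathfrak h(p,q)$ of $\mathfrak{sl}(n,\mathbb C)$. For every $(\alpha,\beta)\in\mathcal{P}'$, $$\mathrm{mult}_{\mathbf S}(\mu(\alpha,\beta))=\#RT(\alpha,\beta),$$ where $RT(\alpha,\beta)$ denotes the set of row-tableaux of shape $\alpha$ and weight $\beta$.
   Context: Let $\mathfrak{g}=\mathfrak{sl}(n,\mathbb{C})$ with $n=p+q$, $\mathfrak{t}$ the diagonal Cartan subalgebra, $\epsilon_i\in\mathfrak{t}^*$ the functional $\mathrm{diag}(t_1,\ldots,t_n)\mapsto t_i$. $\mathfrak h=\mathfrak h(p,q)$ is the subalgebra of block-diagonal matrices with diagonal blocks of sizes $p$ and $q$; its Killing-orthogonal complement is $\mathfrak q$, with positive roots $\Phi^+(\mathfrak q)=\{\epsilon_i-\epsilon_j:1\le i\le p<j\le n\}$. The spin module is $\mathbf S=\bigwedge\mathfrak u^+$, $\mathfrak u^+=\bigoplus_{\alpha\in\Phi^+(\mathfrak q)}\mathfrak g_\alpha$, with $\mathfrak h$ acting through $\mathfrak h\xrightarrow{\mathrm{ad}}\mathfrak{so}(\mathfrak q)\subset\mathbf C(\mathfrak q)\to\mathrm{End}(\mathbf S)$ (Clifford multiplication). Its weights are $\mu(A)=\frac12\big(\sum_{\alpha\in\Phi^+(\mathfrak q)\setminus A}\alpha-\sum_{\alpha\in A}\alpha\big)$, $A\subset\Phi^+(\mathfrak q)$, and $\mathrm{mult}_{\mathbf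 S}(\mu)=\#\{A\subset\Phi^+(\mathfrak q):\mu(A)=\mu\}$. A weight $\sum b_i\epsilon_i$ is identified with $(b_1,\ldots,b_n)$ (with $\sum b_i=0$). $\mathcal P$ is the set of pairs $(\alpha,\beta)$ such that, for some $0\le m\le pq$, $\alpha$ is a partition of $m$ with at most $p$ parts and $\beta$ is a partition of $m$ with at most $q$ parts; write $\alpha=(\alpha_1\ge\cdots\ge\alpha_p\ge0)$, $\beta=(\beta_1\ge\cdots\ge\beta_q\ge0)$. $\mathcal P'=\{(\alpha,\beta)\in\mathcal P:\beta\preceq{}^t\alpha\}$, where ${}^t\alpha$ is the dual (conjugate) partition and $\preceq$ is the dominance order on partitions of the same integer ($\lambda\preceq\lambda'$ iff $\lambda_1+\cdots+\lambda_i\le\lambda_1'+\cdots+\lambda_i'$ for all $i$, padding with zeros). Put $$\mu(\alpha,\beta)=\big(\alpha_1-\tfrac q2,\ldots,\alpha_p-\tfrac q2,\tfrac p2-\beta_q,\ldots,\tfrac p2-\beta_1\big).$$ A row-tableau of shape $\alpha$ and weight $\beta$ is a numbering of the boxes of the Young diagram $\alpha$ by positive integers with exactly $\beta_i$ occurrences of $i$ for every $i$ and with entries (strictly) increasing from left to right along each row. *)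

theory Defs
  imports
    "Jordan_Normal_Form.Matrix"
    "HOL-Library.Function_Algebras"
    "HOL-Library.FuncSet"
begin

section \<open>The Lie algebra and its Levi subalgebra\<close>

text \<open>
  Rows and columns of matrices, entries of lists and coordinates of weights are numbered from 0.
  The pair \<open>(i, j)\<close> with \<open>i \<noteq> j\<close> stands for the root \<open>\<epsilon>\<^sub>i - \<epsilon>\<^sub>j\<close>, whose root space is spanned by
  \<open>elem_mat n (i, j)\<close>; the opposite root is \<open>prod.swap (i, j)\<close>.
\<close>

definition mat_trace :: "complex mat \<Rightarrow> complex" where
  "mat_trace X = (\<Sum>i<dim_row X. X $$ (i, i))"

definition sl_alg :: "nat \<Rightarrow> complex mat set" where
  "sl_alg n = {X \<in> carrier_mat n n. mat_trace X = 0}"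

definition lie_bracket :: "complex mat \<Rightarrow> complex mat \<Rightarrow> complex mat" where
  "lie_bracket X Y = X * Y - Y * X"

definition elem_mat :: "nat \<Rightarrow> nat \<times> nat \<Rightarrow> complex mat" where
  "elem_mat n a = mat n n (\<lambda>ij. if ij = a then 1 else 0)"

text \<open>
  The trace of \<open>ad X \<circ> ad Y\<close>, computed on \<open>gl n\<close>. For \<open>X, Y \<in> sl_alg n\<close> it is the trace on
  \<open>sl_alg n\<close>, because \<open>ad X \<circ> ad Y\<close> maps \<open>gl n\<close> into \<open>sl_alg n\<close>.
\<close>
definition killing :: "nat \<Rightarrow> complex mat \<Rightarrow> complex mat \<Rightarrow> complex" where
  "killing n X Y =
     (\<Sum>i<n. \<Sum>j<n. lie_bracket X (lie_bracket Y (elem_mat n (i, j))) $$ (i, j))"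

definition cartan :: "nat \<Rightarrow> complex mat set" where
  "cartan n = {H \<in> sl_alg n. diagonal_mat H}"

definition levi :: "nat \<Rightarrow> nat \<Rightarrow> complex mat set" where
  "levi p q = {X \<in> sl_alg (p + q).
     \<forall>i<p + q. \<forall>j<p + q. (i < p) \<noteq> (j < p) \<longrightarrow> X $$ (i, j) = 0}"

definition levi_compl :: "nat \<Rightarrow> nat \<Rightarrow> complex mat set" where
  "levi_compl p q = {X \<in> sl_alg (p + q). \<forall>Y\<in>levi p q. killing (p + q) X Y = 0}"

definition pos_roots :: "nat \<Rightarrow> nat \<Rightarrow> (nat \<times> nat) set" where
  "pos_roots p q = {(i, j). i < p \<and> p \<le> j \<and> j < p + q}"


section \<open>The spin module\<close>

text \<open>
  \<open>s\<close> in \<open>spinors p q\<close> stands for the element \<open>\<Sum>A. s A \<cdot> e\<^sub>A\<close> of the exterior algebra of \<open>u\<^sup>+\<close>, where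
  \<open>e\<^sub>A\<close> is the wedge product, in lexicographic order, of the root vectors \<open>elem_mat (p + q) a\<close>,
  \<open>a \<in> A\<close>.
\<close>

type_synonym spinor = "(nat \<times> nat) set \<Rightarrow> complex"

definition spinors :: "nat \<Rightarrow> nat \<Rightarrow> spinor set" where
  "spinors p q = {s. \<forall>A. \<not> A \<subseteq> pos_roots p q \<longrightarrow> s A = 0}"

definition spinor_scale :: "complex \<Rightarrow> spinor \<Rightarrow> spinor" where
  "spinor_scale c s = (\<lambda>A. c * s A)"

lemma vector_space_spinor_scale: "vector_space spinor_scale"
  by unfold_locales (auto simp: spinor_scale_def fun_eq_iff algebra_simps)

definition koszul_sign :: "nat \<times> nat \<Rightarrow> (nat \<times> nat) set \<Rightarrow> complex" where
  "koszul_sign a A = (-1) ^ card {b \<in> A. fst b < fst a \<or> fst b = fst a \<and> snd b < snd a}"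

text \<open>Exterior multiplication by the root vector of \<open>a\<close>.\<close>
definition wedge :: "nat \<times> nat \<Rightarrow> spinor \<Rightarrow> spinor" where
  "wedge a s = (\<lambda>A. if a \<in> A then koszul_sign a A * s (A - {a}) else 0)"

text \<open>Contraction with the element of the dual basis of \<open>u\<^sup>+\<close> corresponding to \<open>a\<close>.\<close>
definition contract :: "nat \<times> nat \<Rightarrow> spinor \<Rightarrow> spinor" where
  "contract a s = (\<lambda>A. if a \<notin> A then koszul_sign a A * s (insert a A) else 0)"

text \<open>
  Clifford multiplication by \<open>v \<in> levi_compl p q\<close>. Write \<open>v = v\<^sup>+ + v\<^sup>-\<close> with \<open>v\<^sup>\<plusminus> \<in> u\<^sup>\<plusminus>\<close>; then \<open>v\<close> acts as
  exterior multiplication by \<open>v\<^sup>+\<close> plus twice the contraction with the linear form \<open>killing v\<close> on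
  \<open>u\<^sup>+\<close> (which only depends on \<open>v\<^sup>-\<close>, as \<open>u\<^sup>+\<close> is isotropic). This gives the Clifford relations
  \<open>v w + w v = 2 killing v w\<close>.
\<close>
definition clifford :: "nat \<Rightarrow> nat \<Rightarrow> complex mat \<Rightarrow> spinor \<Rightarrow> spinor" where
  "clifford p q v s = (\<lambda>A.
     (\<Sum>a\<in>pos_roots p q. v $$ a * wedge a s A) +
     2 * (\<Sum>a\<in>pos_roots p q. killing (p + q) v (elem_mat (p + q) a) * contract a s A))"

text \<open>
  With the above Clifford relations, the embedding of \<open>so(levi_compl p q)\<close> in the Clifford algebra
  is \<open>T \<mapsto> 1/4 \<Sum>\<^sub>k T(x\<^sub>k) y\<^sub>k\<close> for any pair of dual bases \<open>(x\<^sub>k)\<close>, \<open>(y\<^sub>k)\<close>: the commutator with the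
  image of \<open>T\<close> is \<open>T\<close> on \<open>levi_compl p q\<close>. It is used here for \<open>T = ad X\<close>, with \<open>x\<^sub>k\<close> the root vectors
  of \<open>levi_compl p q\<close> and \<open>y\<^sub>k\<close> the normalised opposite root vectors.
\<close>
definition spin_action :: "nat \<Rightarrow> nat \<Rightarrow> complex mat \<Rightarrow> spinor \<Rightarrow> spinor" where
  "spin_action p q X s = (\<lambda>A. 1 / 4 *
     (\<Sum>a\<in>pos_roots p q \<union> prod.swap ` pos_roots p q.
        clifford p q (lie_bracket X (elem_mat (p + q) a))
          (clifford p q (elem_mat (p + q) (prod.swap a)) s) A /
        killing (p + q) (elem_mat (p + q) a) (elem_mat (p + q) (prod.swap a))))"

text \<open>The sequence \<open>b\<close> stands for the weight \<open>\<Sum>i<n. b i \<cdot> \<epsilon>\<^sub>i\<close>.\<close>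

definition weight_eval :: "nat \<Rightarrow> (nat \<Rightarrow> complex) \<Rightarrow> complex mat \<Rightarrow> complex" where
  "weight_eval n b H = (\<Sum>i<n. b i * H $$ (i, i))"

definition spin_weight_space :: "nat \<Rightarrow> nat \<Rightarrow> (nat \<Rightarrow> complex) \<Rightarrow> spinor set" where
  "spin_weight_space p q b = {s \<in> spinors p q.
     \<forall>H\<in>cartan (p + q). spin_action p q H s = spinor_scale (weight_eval (p + q) b H) s}"

definition spin_mult :: "nat \<Rightarrow> nat \<Rightarrow> (nat \<Rightarrow> complex) \<Rightarrow> nat" where
  "spin_mult p q b = vector_space.dim spinor_scale (spin_weight_space p q b)"


section \<open>Partitions and row-tableaux\<close>

text \<open>A partition with at most \<open>k\<close> parts is a weakly decreasing list of length \<open>k\<close>, padded with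
  zeros; \<open>part\<close> extends it by zeros indefinitely.\<close>

definition partition_of :: "nat \<Rightarrow> nat \<Rightarrow> nat list \<Rightarrow> bool" where
  "partition_of m k xs \<longleftrightarrow> length xs = k \<and> sorted_wrt (\<ge>) xs \<and> sum_list xs = m"

definition part :: "nat list \<Rightarrow> nat \<Rightarrow> nat" where
  "part xs i = (if i < length xs then xs ! i else 0)"

definition young :: "nat list \<Rightarrow> (nat \<times> nat) set" where
  "young xs = {(r, c). c < part xs r}"

definition conjugate_part :: "nat list \<Rightarrow> nat list" where
  "conjugate_part xs = map (\<lambda>c. card {r. (r, c) \<in> young xs}) [0..<part xs 0]"

definition dominated :: "nat list \<Rightarrow> nat list \<Rightarrow> bool" where
  "dominated xs ys \<longleftrightarrow> sum_list xs = sum_list ys \<and>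
     (\<forall>k. (\<Sum>i<k. part xs i) \<le> (\<Sum>i<k. part ys i))"

definition PP :: "nat \<Rightarrow> nat \<Rightarrow> (nat list \<times> nat list) set" where
  "PP p q = {(\<alpha>, \<beta>). \<exists>m\<le>p * q. partition_of m p \<alpha> \<and> partition_of m q \<beta>}"

definition PP' :: "nat \<Rightarrow> nat \<Rightarrow> (nat list \<times> nat list) set" where
  "PP' p q = {(\<alpha>, \<beta>) \<in> PP p q. dominated \<beta> (conjugate_part \<alpha>)}"

definition mu :: "nat \<Rightarrow> nat \<Rightarrow> nat list \<Rightarrow> nat list \<Rightarrow> nat \<Rightarrow> complex" where
  "mu p q \<alpha> \<beta> i =
     (if i < p then of_nat (\<alpha> ! i) - of_nat q / 2
      else of_nat p / 2 - of_nat (\<beta> ! (p + q - 1 - i)))"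

text \<open>The number \<open>k + 1\<close> has multiplicity \<open>part \<beta> k\<close>, since lists are indexed from 0.\<close>
definition row_tableaux :: "nat list \<Rightarrow> nat list \<Rightarrow> (nat \<times> nat \<Rightarrow> nat) set" where
  "row_tableaux \<alpha> \<beta> = {T \<in> young \<alpha> \<rightarrow>\<^sub>E {1..}.
     (\<forall>k. card {x \<in> young \<alpha>. T x = Suc k} = part \<beta> k) \<and>
     (\<forall>r c c'. c < c' \<and> (r, c') \<in> young \<alpha> \<longrightarrow> T (r, c) < T (r, c'))}"

end

theory Submission
  imports Defs
begin

text \<open>
  Composing the Clifford actions of opposite root vectors shows that a diagonal matrix \<open>H\<close> acts on
  \<open>e\<^sub>A\<close> by the scalar \<open>1/2 (\<Sum>a\<in>A. a(H) - \<Sum>a\<notin>A. a(H))\<close>. Hence the \<open>e\<^sub>A\<close> form a basis of weight vectors, and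
  the weight of \<open>e\<^sub>A\<close> is read off from the row and column sums of the 0-1 matrix of \<open>A\<close>; the weight
  \<open>mu p q \<alpha> \<beta>\<close> corresponds to row sums \<open>\<alpha>\<close> and column sums \<open>\<beta>\<close> reversed. Listing the columns occupied by
  each row in increasing order (after reversal) turns such a matrix into a row-tableau.
  Linear forms on the trace-zero diagonal matrices only determine coefficient vectors up to a
  constant, which is why coordinate sums equal to zero are tracked.
\<close>

section \<open>The Killing form and the Clifford action\<close>

lemma elem_mat_carrier [simp]: "elem_mat n a \<in> carrier_mat n n"
  by (simp add: elem_mat_def)

lemma elem_mat_index:
  "i < n \<Longrightarrow> j < n \<Longrightarrow> elem_mat n a $$ (i, j) = (if (i, j) = a then 1 else 0)"
  by (simp add: elem_mat_def)

lemma lie_bracket_carrier [simp]: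
  "X \<in> carrier_mat n n \<Longrightarrow> Y \<in> carrier_mat n n \<Longrightarrow> lie_bracket X Y \<in> carrier_mat n n"
  unfolding lie_bracket_def by (intro minus_carrier_mat mult_carrier_mat)

lemma mult_mat_index_sum:
  assumes "X \<in> carrier_mat n n" "Y \<in> carrier_mat n n" "i < n" "j < n"
  shows "(X * Y) $$ (i, j) = (\<Sum>k<n. X $$ (i, k) * Y $$ (k, j))"
  using assms by (simp add: scalar_prod_def atLeast0LessThan)

lemma lie_bracket_index:
  assumes "X \<in> carrier_mat n n" "Y \<in> carrier_mat n n" "i < n" "j < n"
  shows "lie_bracket X Y $$ (i, j) =
    (\<Sum>k<n. X $$ (i, k) * Y $$ (k, j)) - (\<Sum>k<n. Y $$ (i, k) * X $$ (k, j))"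
  using assms by (simp add: lie_bracket_def mult_mat_index_sum[OF assms(1,2)]
      mult_mat_index_sum[OF assms(2,1)] del: index_mult_mat(1))

lemma sum_Pair_delta_left:
  fixes f :: "nat \<Rightarrow> complex"
  assumes "i < n"
  shows "(\<Sum>k<n. f k * (if (k, l) = (i, j) then 1 else 0)) = (if l = j then f i else 0)"
  using assms by (cases "l = j") (simp_all add: if_distrib cong: if_cong)

lemma sum_Pair_delta_right:
  fixes f :: "nat \<Rightarrow> complex"
  assumes "j < n"
  shows "(\<Sum>k<n. (if (l, k) = (i, j) then 1 else 0) * f k) = (if l = i then f j else 0)"
proof -
  have "(\<Sum>k<n. (if (l, k) = (i, j) then 1 else 0) * f k) =
      (\<Sum>k<n. if k = j then (if l = i then f k else 0) else 0)"
    by (rule sum.cong) auto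
  then show ?thesis using assms by simp
qed

text \<open>Multiplying \<open>Y\<close> by the matrix unit on the right moves column
  \<open>i\<close> into column \<open>j\<close>; multiplying on the left moves row \<open>j\<close>
  into row \<open>i\<close>.\<close>

lemma lie_bracket_elem_mat_index:
  assumes "Y \<in> carrier_mat n n" "i < n" "j < n" "k < n" "l < n"
  shows "lie_bracket Y (elem_mat n (i, j)) $$ (k, l) =
    (if l = j then Y $$ (k, i) else 0) - (if k = i then Y $$ (j, l) else 0)"
proof -
  have "(\<Sum>m<n. Y $$ (k, m) * elem_mat n (i, j) $$ (m, l)) =
      (\<Sum>m<n. Y $$ (k, m) * (if (m, l) = (i, j) then 1 else 0))"
    using assms by (intro sum.cong) (auto simp: elem_mat_index)
  moreover have "(\<Sum>m<n. elem_mat n (i, j) $$ (k, m) * Y $$ (m, l)) =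
      (\<Sum>m<n. (if (k, m) = (i, j) then 1 else 0) * Y $$ (m, l))"
    using assms by (intro sum.cong) (auto simp: elem_mat_index)
  ultimately show ?thesis
    using assms by (simp only: lie_bracket_index[OF assms(1) elem_mat_carrier assms(4,5)]
        sum_Pair_delta_left sum_Pair_delta_right)
qed

text \<open>This is 2n tr(XY) - 2 tr(X) tr(Y). Applied to a matrix unit E, the iterated bracket is
  XYE - XEY - YEX + EYX, and each of the four terms has an explicit coefficient at E.\<close>

lemma killing_eq:
  assumes X: "X \<in> carrier_mat n n" and Y: "Y \<in> carrier_mat n n"
  shows "killing n X Y = 2 * of_nat n * (\<Sum>i<n. \<Sum>k<n. X $$ (i, k) * Y $$ (k, i))
    - 2 * (\<Sum>i<n. X $$ (i, i)) * (\<Sum>i<n. Y $$ (i, i))"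
proof -
  \<comment> \<open>\<open>S i\<close> and \<open>R j\<close> are the diagonal entries of XY and YX,
    whose traces agree.\<close>
  define S where "S i = (\<Sum>k<n. X $$ (i, k) * Y $$ (k, i))" for i
  define R where "R j = (\<Sum>k<n. Y $$ (j, k) * X $$ (k, j))" for j
  have "lie_bracket X (lie_bracket Y (elem_mat n (i, j))) $$ (i, j) =
      S i - X $$ (i, i) * Y $$ (j, j) - (Y $$ (i, i) * X $$ (j, j) - R j)"
    if ij: "i < n" "j < n" for i j
  proof -
    let ?Z = "lie_bracket Y (elem_mat n (i, j))"
    have "(\<Sum>k<n. X $$ (i, k) * ?Z $$ (k, j)) =
        (\<Sum>k<n. X $$ (i, k) * Y $$ (k, i) - (if k = i then X $$ (i, k) * Y $$ (j, j) else 0))"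
      using ij by (intro sum.cong)
        (auto simp: lie_bracket_elem_mat_index[OF Y] algebra_simps)
    also have "\<dots> = S i - X $$ (i, i) * Y $$ (j, j)"
      using ij by (simp add: sum_subtractf S_def)
    finally have 1: "(\<Sum>k<n. X $$ (i, k) * ?Z $$ (k, j)) = S i - X $$ (i, i) * Y $$ (j, j)" .
    have "(\<Sum>k<n. ?Z $$ (i, k) * X $$ (k, j)) =
        (\<Sum>k<n. (if k = j then Y $$ (i, i) * X $$ (k, j) else 0) - Y $$ (j, k) * X $$ (k, j))"
      using ij by (intro sum.cong)
        (auto simp: lie_bracket_elem_mat_index[OF Y] algebra_simps)
    also have "\<dots> = Y $$ (i, i) * X $$ (j, j) - R j"
      using ij by (simp add: sum_subtractf R_def)
    finally show ?thesis
      using 1 X Y ij by (simp add: lie_bracket_index)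
  qed
  then have "killing n X Y =
      (\<Sum>i<n. \<Sum>j<n. S i - X $$ (i, i) * Y $$ (j, j) - (Y $$ (i, i) * X $$ (j, j) - R j))"
    by (simp add: killing_def)
  also have "\<dots> = (\<Sum>i<n. \<Sum>j<n. S i) - (\<Sum>i<n. \<Sum>j<n. X $$ (i, i) * Y $$ (j, j))
      - ((\<Sum>i<n. \<Sum>j<n. Y $$ (i, i) * X $$ (j, j)) - (\<Sum>i<n. \<Sum>j<n. R j))"
    by (simp only: sum_subtractf)
  also have "\<dots> = of_nat n * (\<Sum>i<n. S i) - (\<Sum>i<n. X $$ (i, i)) * (\<Sum>i<n. Y $$ (i, i))
      - ((\<Sum>i<n. Y $$ (i, i)) * (\<Sum>i<n. X $$ (i, i)) - of_nat n * (\<Sum>i<n. R i))"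
    by (simp only: sum_product) (simp flip: sum_distrib_left)
  also have "(\<Sum>i<n. R i) = (\<Sum>i<n. S i)"
    unfolding R_def S_def by (subst sum.swap) (simp add: mult.commute)
  finally show ?thesis by (simp add: S_def algebra_simps)
qed

text \<open>An off-diagonal matrix unit has trace 0, so only the trace of the product survives. Each
  root space therefore pairs only with the opposite one.\<close>

lemma killing_elem_mat:
  assumes X: "X \<in> carrier_mat n n" and ij: "i < n" "j < n" "i \<noteq> j"
  shows "killing n X (elem_mat n (i, j)) = 2 * of_nat n * X $$ (j, i)"
proof -
  have "(\<Sum>l<n. \<Sum>k<n. X $$ (l, k) * elem_mat n (i, j) $$ (k, l)) =
      (\<Sum>l<n. \<Sum>k<n. X $$ (l, k) * (if (k, l) = (i, j) then 1 else 0))"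
    by (intro sum.cong) (auto simp: elem_mat_index)
  also have "\<dots> = (\<Sum>l<n. if l = j then X $$ (l, i) else 0)"
    using ij by (intro sum.cong) (simp_all only: sum_Pair_delta_left)
  also have "\<dots> = X $$ (j, i)" using ij by simp
  finally have "(\<Sum>l<n. \<Sum>k<n. X $$ (l, k) * elem_mat n (i, j) $$ (k, l)) = X $$ (j, i)" .
  moreover have "(\<Sum>l<n. elem_mat n (i, j) $$ (l, l)) = 0"
    using ij by (intro sum.neutral) (auto simp: elem_mat_index)
  ultimately show ?thesis by (simp add: killing_eq[OF X])
qed

lemma pos_roots_eq: "pos_roots p q = {..<p} \<times> {p..<p + q}"
  by (auto simp: pos_roots_def)

lemma finite_pos_roots [simp]: "finite (pos_roots p q)"
  by (simp add: pos_roots_eq)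

text \<open>The factor 4n is the 2n of \<open>killing_elem_mat\<close> doubled by the normalisation
  of the contraction; \<open>prod.swap\<close> appears because the Killing form pairs opposite
  roots.\<close>

lemma clifford_eq:
  assumes v: "v \<in> carrier_mat (p + q) (p + q)"
  shows "clifford p q v s A = (\<Sum>a\<in>pos_roots p q. v $$ a * wedge a s A) +
     4 * of_nat (p + q) * (\<Sum>a\<in>pos_roots p q. v $$ prod.swap a * contract a s A)"
proof -
  have "(\<Sum>a\<in>pos_roots p q. killing (p + q) v (elem_mat (p + q) a) * contract a s A) =
      (\<Sum>a\<in>pos_roots p q. 2 * of_nat (p + q) * (v $$ prod.swap a * contract a s A))"
  proof (rule sum.cong)
    fix a assume "a \<in> pos_roots p q"
    then obtain i j where "a = (i, j)" "i < p" "p \<le> j" "j < p + q" by (auto simp: pos_roots_def)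
    then show "killing (p + q) v (elem_mat (p + q) a) * contract a s A =
        2 * of_nat (p + q) * (v $$ prod.swap a * contract a s A)"
      using killing_elem_mat[OF v, of i j] by simp
  qed simp
  then show ?thesis
    by (simp only: clifford_def sum_distrib_left[symmetric]) (simp add: algebra_simps)
qed

text \<open>The following two lemmas are stated for an arbitrary matrix with a single nonzero entry, so
  that they apply both to root vectors and to their brackets with the Cartan subalgebra.\<close>

lemma clifford_pos_root:
  assumes v: "v \<in> carrier_mat (p + q) (p + q)" and a: "a \<in> pos_roots p q"
    and "\<And>i j. i < p + q \<Longrightarrow> j < p + q \<Longrightarrow> v $$ (i, j) = (if (i, j) = a then c else 0)"
  shows "clifford p q v s A = c * wedge a s A"
proof -
  have "(\<Sum>b\<in>pos_roots p q. v $$ b * wedge b s A) =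
      (\<Sum>b\<in>pos_roots p q. if b = a then c * wedge b s A else 0)"
    by (rule sum.cong) (auto simp: pos_roots_def assms(3))
  moreover have "(\<Sum>b\<in>pos_roots p q. v $$ prod.swap b * contract b s A) = 0"
    by (rule sum.neutral) (use a in \<open>auto simp: pos_roots_def assms(3)\<close>)
  ultimately show ?thesis using a by (simp add: clifford_eq[OF v])
qed

lemma clifford_neg_root:
  assumes v: "v \<in> carrier_mat (p + q) (p + q)" and a: "a \<in> pos_roots p q"
    and "\<And>i j. i < p + q \<Longrightarrow> j < p + q \<Longrightarrow> v $$ (i, j) = (if (i, j) = prod.swap a then c else 0)"
  shows "clifford p q v s A = 4 * of_nat (p + q) * c * contract a s A"
proof -
  have "(\<Sum>b\<in>pos_roots p q. v $$ prod.swap b * contract b s A) =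
      (\<Sum>b\<in>pos_roots p q. if b = a then c * contract b s A else 0)"
    by (intro sum.cong refl) (cases a, auto simp: pos_roots_def assms(3) split: if_splits)
  moreover have "(\<Sum>b\<in>pos_roots p q. v $$ b * wedge b s A) = 0"
    by (rule sum.neutral) (use a in \<open>auto simp: pos_roots_def assms(3)\<close>)
  ultimately show ?thesis using a by (simp add: clifford_eq[OF v])
qed

section \<open>Wedge and contraction by a single root vector\<close>

lemma koszul_sign_square [simp]: "koszul_sign a A * koszul_sign a A = 1"
  by (simp add: koszul_sign_def flip: power_add mult_2)

lemma koszul_sign_square' [simp]: "koszul_sign a A * (koszul_sign a A * z) = z"
  by (simp flip: mult.assoc)

text \<open>The sign counts only elements strictly preceding \<open>a\<close>, so the presence of
  \<open>a\<close> itself is irrelevant.\<close>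

lemma koszul_sign_remove [simp]: "koszul_sign a (A - {a}) = koszul_sign a A"
  unfolding koszul_sign_def by (rule arg_cong[where f = "\<lambda>B. (-1) ^ card B"]) auto

lemma koszul_sign_insert [simp]: "koszul_sign a (insert a A) = koszul_sign a A"
  unfolding koszul_sign_def by (rule arg_cong[where f = "\<lambda>B. (-1) ^ card B"]) auto

text \<open>The same sign occurs twice and cancels. Together with \<open>contract_wedge\<close> this
  yields complementary projections, according to whether \<open>a\<close> lies in
  \<open>A\<close>.\<close>

lemma wedge_contract: "wedge a (contract a s) A = (if a \<in> A then s A else 0)"
  by (simp add: wedge_def contract_def insert_absorb)

lemma contract_wedge: "contract a (wedge a s) A = (if a \<in> A then 0 else s A)"
  by (simp add: wedge_def contract_def)

lemma wedge_scale: "wedge a (\<lambda>A. c * s A) A = c * wedge a s A"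
  by (simp add: wedge_def)

text \<open>The matrix unit is an eigenvector of ad \<open>H\<close>, so the bracket keeps the
  single-entry form required by \<open>clifford_pos_root\<close> and
  \<open>clifford_neg_root\<close>.\<close>

lemma lie_bracket_cartan_index:
  assumes "H \<in> cartan n" "i < n" "j < n" "k < n" "l < n"
  shows "lie_bracket H (elem_mat n (i, j)) $$ (k, l) =
    (if (k, l) = (i, j) then H $$ (i, i) - H $$ (j, j) else 0)"
proof -
  have H: "H \<in> carrier_mat n n" "\<And>i j. i < n \<Longrightarrow> j < n \<Longrightarrow> i \<noteq> j \<Longrightarrow> H $$ (i, j) = 0"
    using assms(1) by (auto simp: cartan_def sl_alg_def diagonal_mat_def)
  show ?thesis
    using lie_bracket_elem_mat_index[OF H(1) assms(2-5)] H(2) assms(2-5) by auto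
qed

text \<open>The summand of a positive root is wedge after contraction and lives on sets containing
  it; that of the opposite root is contraction after wedge, lives on the other sets and has the
  opposite sign. Each carries a factor 2, which turns 1/4 into 1/2.\<close>

lemma spin_action_cartan:
  assumes H: "H \<in> cartan (p + q)"
  shows "spin_action p q H s A = 1 / 2 * (\<Sum>a\<in>pos_roots p q.
    (H $$ (fst a, fst a) - H $$ (snd a, snd a)) * (if a \<in> A then 1 else -1)) * s A"
proof -
  let ?n = "p + q" and ?P = "pos_roots p q"
  define f where "f a = clifford p q (lie_bracket H (elem_mat ?n a))
          (clifford p q (elem_mat ?n (prod.swap a)) s) A /
        killing ?n (elem_mat ?n a) (elem_mat ?n (prod.swap a))" for a
  have Hc: "H \<in> carrier_mat ?n ?n" using H by (simp add: cartan_def sl_alg_def)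
  have f: "f a + f (prod.swap a) =
      2 * ((H $$ (fst a, fst a) - H $$ (snd a, snd a)) * (if a \<in> A then 1 else -1)) * s A"
    if a: "a \<in> ?P" for a
  proof -
    obtain i j where ij: "a = (i, j)" "i < p" "p \<le> j" "j < ?n"
      using a by (auto simp: pos_roots_def)
    let ?h = "H $$ (i, i) - H $$ (j, j)"
    \<comment> \<open>The Clifford actions contribute 4n and the Killing form 2n; n is nonzero since
      there is a root, so the quotient is 2.\<close>
    define N :: complex where "N = of_nat ?n"
    have N: "N \<noteq> 0" using ij by (simp add: N_def flip: of_nat_add)
    have "clifford p q (elem_mat ?n (j, i)) s = (\<lambda>A. 4 * N * contract a s A)"
      using clifford_neg_root[OF elem_mat_carrier a, of "prod.swap a" 1] ij
      by (simp add: fun_eq_iff elem_mat_index N_def)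
    then have "clifford p q (lie_bracket H (elem_mat ?n (i, j)))
          (clifford p q (elem_mat ?n (j, i)) s) A = ?h * (4 * N * (if a \<in> A then s A else 0))"
      using clifford_pos_root[OF lie_bracket_carrier[OF Hc elem_mat_carrier] a, of "(i, j)" ?h]
        lie_bracket_cartan_index[OF H, of i j] ij
      by (simp add: wedge_scale wedge_contract)
    moreover have "killing ?n (elem_mat ?n (i, j)) (elem_mat ?n (j, i)) = 2 * N"
      using killing_elem_mat[OF elem_mat_carrier, of j ?n i "(i, j)"] ij
      by (simp add: elem_mat_index N_def)
    ultimately have "f a = ?h * (4 * N * (if a \<in> A then s A else 0)) / (2 * N)"
      by (simp only: f_def ij(1) swap_simp)
    then have 1: "f a = 2 * ?h * (if a \<in> A then s A else 0)"
      using N by simp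
    have "clifford p q (elem_mat ?n (i, j)) s = wedge a s"
      using clifford_pos_root[OF elem_mat_carrier a, of "(i, j)" 1] ij
      by (simp add: fun_eq_iff elem_mat_index)
    then have "clifford p q (lie_bracket H (elem_mat ?n (j, i)))
          (clifford p q (elem_mat ?n (i, j)) s) A = 4 * N * (- ?h) * (if a \<in> A then 0 else s A)"
      using clifford_neg_root[OF lie_bracket_carrier[OF Hc elem_mat_carrier] a, of "(j, i)" "- ?h"]
        lie_bracket_cartan_index[OF H, of j i] ij
      by (simp add: contract_wedge N_def)
    moreover have "killing ?n (elem_mat ?n (j, i)) (elem_mat ?n (i, j)) = 2 * N"
      using killing_elem_mat[OF elem_mat_carrier, of i ?n j "(j, i)"] ij
      by (simp add: elem_mat_index N_def)
    ultimately have "f (prod.swap a) = 4 * N * (- ?h) * (if a \<in> A then 0 else s A) / (2 * N)"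
      by (simp only: f_def ij(1) swap_simp)
    then have "f (prod.swap a) = - 2 * ?h * (if a \<in> A then 0 else s A)"
      using N by simp
    with 1 ij show ?thesis by simp
  qed
  have "?P \<inter> prod.swap ` ?P = {}" by (auto simp: pos_roots_def)
  then have "(\<Sum>a\<in>?P \<union> prod.swap ` ?P. f a) = (\<Sum>a\<in>?P. f a) + (\<Sum>a\<in>prod.swap ` ?P. f a)"
    by (simp add: sum.union_disjoint)
  also have "(\<Sum>a\<in>prod.swap ` ?P. f a) = (\<Sum>a\<in>?P. f (prod.swap a))"
    by (subst sum.reindex) (auto simp: inj_on_def)
  also have "(\<Sum>a\<in>?P. f a) + \<dots> = (\<Sum>a\<in>?P.
      2 * ((H $$ (fst a, fst a) - H $$ (snd a, snd a)) * (if a \<in> A then 1 else -1)) * s A)"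
    unfolding sum.distrib[symmetric] by (intro sum.cong refl f)
  also have "\<dots> = 2 * (\<Sum>a\<in>?P.
      (H $$ (fst a, fst a) - H $$ (snd a, snd a)) * (if a \<in> A then 1 else -1)) * s A"
    by (simp only: sum_distrib_left sum_distrib_right)
  finally show ?thesis unfolding spin_action_def f_def by simp
qed


section \<open>Weight spaces of the spin module\<close>

text \<open>Coordinates of half the sum of the roots in \<open>A\<close> minus half the sum of the
  others. Relative to the usual indexing of the spin weights, \<open>A\<close> is replaced by its
  complement, which leaves multiplicities unchanged.\<close>

definition subset_weight :: "nat \<Rightarrow> nat \<Rightarrow> (nat \<times> nat) set \<Rightarrow> nat \<Rightarrow> complex" where
  "subset_weight p q A i =
     (if i < p then of_nat (card {j. (i, j) \<in> A}) - of_nat q / 2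
      else of_nat p / 2 - of_nat (card {j. (j, i) \<in> A}))"

lemma sum_sign:
  assumes "finite S"
  shows "(\<Sum>x\<in>S. if P x then 1 else -1 :: complex) = 2 * of_nat (card {x \<in> S. P x}) - of_nat (card S)"
proof -
  have "(\<Sum>x\<in>S. if P x then 1 else -1 :: complex) = (\<Sum>x\<in>S. 2 * (if P x then 1 else 0) - 1)"
    by (rule sum.cong) auto
  also have "\<dots> = 2 * (\<Sum>x\<in>S. if P x then 1 else 0) - of_nat (card S)"
    by (simp add: sum_subtractf sum_distrib_left)
  also have "(\<Sum>x\<in>S. if P x then 1 else 0 :: complex) = of_nat (card {x \<in> S. P x})"
    using assms by (simp add: sum.If_cases Int_def)
  finally show ?thesis .
qed

lemma sum_lessThan_add:
  fixes f :: "nat \<Rightarrow> 'a :: comm_monoid_add"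
  shows "(\<Sum>i<p + q. f i) = (\<Sum>i<p. f i) + (\<Sum>i\<in>{p..<p + q}. f i)"
  using sum.atLeastLessThan_concat[of 0 p "p + q" f] by (simp add: atLeast0LessThan)

text \<open>Collecting the coefficient of each \<open>h i\<close> leaves a signed row sum for
  \<open>i < p\<close> and minus a signed column sum otherwise.\<close>

lemma half_sum_pos_roots:
  assumes A: "A \<subseteq> pos_roots p q"
  shows "1 / 2 * (\<Sum>a\<in>pos_roots p q. (h (fst a) - h (snd a)) * (if a \<in> A then 1 else -1)) =
    (\<Sum>i<p + q. subset_weight p q A i * h i)"
proof -
  let ?e = "\<lambda>i j. if (i, j) \<in> A then 1 else -1 :: complex"
  have row: "(\<Sum>j\<in>{p..<p + q}. ?e i j) = 2 * subset_weight p q A i" if "i < p" for i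
  proof -
    have "{j \<in> {p..<p + q}. (i, j) \<in> A} = {j. (i, j) \<in> A}"
      using A by (auto simp: pos_roots_def)
    then show ?thesis using that by (simp add: sum_sign subset_weight_def)
  qed
  have col: "(\<Sum>i<p. ?e i j) = - 2 * subset_weight p q A j" if "p \<le> j" for j
  proof -
    have "{i \<in> {..<p}. (i, j) \<in> A} = {i. (i, j) \<in> A}"
      using A by (auto simp: pos_roots_def)
    then show ?thesis using that by (simp add: sum_sign subset_weight_def)
  qed
  have "(\<Sum>a\<in>pos_roots p q. (h (fst a) - h (snd a)) * (if a \<in> A then 1 else -1)) =
      (\<Sum>i<p. \<Sum>j\<in>{p..<p + q}. (h i - h j) * ?e i j)"
    unfolding pos_roots_eq by (subst sum.cartesian_product) (simp add: case_prod_unfold)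
  also have "\<dots> = (\<Sum>i<p. \<Sum>j\<in>{p..<p + q}. h i * ?e i j)
      - (\<Sum>i<p. \<Sum>j\<in>{p..<p + q}. h j * ?e i j)"
    by (simp only: left_diff_distrib sum_subtractf)
  also have "(\<Sum>i<p. \<Sum>j\<in>{p..<p + q}. h i * ?e i j) = (\<Sum>i<p. h i * (\<Sum>j\<in>{p..<p + q}. ?e i j))"
    by (simp only: sum_distrib_left)
  also have "\<dots> = (\<Sum>i<p. h i * (2 * subset_weight p q A i))"
    by (intro sum.cong refl) (simp only: row lessThan_iff)
  also have "(\<Sum>i<p. \<Sum>j\<in>{p..<p + q}. h j * ?e i j) = (\<Sum>j\<in>{p..<p + q}. h j * (\<Sum>i<p. ?e i j))"
    by (subst sum.swap) (simp only: sum_distrib_left)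
  also have "\<dots> = (\<Sum>j\<in>{p..<p + q}. h j * (- 2 * subset_weight p q A j))"
    by (intro sum.cong refl) (simp only: col atLeastLessThan_iff)
  finally show ?thesis
    by (simp add: sum_lessThan_add sum_distrib_left sum_negf algebra_simps)
qed

text \<open>Every root vanishes on the constant function 1.\<close>

lemma sum_subset_weight:
  assumes "A \<subseteq> pos_roots p q"
  shows "(\<Sum>i<p + q. subset_weight p q A i) = 0"
  using half_sum_pos_roots[OF assms, of "\<lambda>_. 1"] by simp

lemma cartan_separates:
  assumes "(\<Sum>i<n. b i) = 0" "\<And>H. H \<in> cartan n \<Longrightarrow> weight_eval n b H = 0" "i < n"
  shows "b i = 0"
proof -
  have eq: "b k = b i" if k: "k < n" for k
  proof (cases "k = i")
    case False
    \<comment> \<open>The test matrix has 1 at position \<open>k\<close> and -1 at position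
      \<open>i\<close>, hence trace 0; evaluating on it compares two coordinates of
      \<open>b\<close>.\<close>
    let ?d = "\<lambda>l. (if l = k then 1 else 0) - (if l = i then 1 else 0) :: complex"
    define H where "H = mat n n (\<lambda>(l, m). if l = m then ?d l else 0)"
    have "mat_trace H = (\<Sum>l<n. ?d l)" by (simp add: mat_trace_def H_def)
    also have "\<dots> = 0" using k assms(3) by (simp add: sum_subtractf)
    finally have "H \<in> cartan n" by (simp add: cartan_def sl_alg_def diagonal_mat_def H_def)
    then have "0 = weight_eval n b H" by (simp add: assms(2))
    also have "\<dots> = (\<Sum>l<n. (if l = k then b l else 0) - (if l = i then b l else 0))"
      unfolding weight_eval_def by (rule sum.cong) (auto simp: H_def)
    also have "\<dots> = b k - b i" using k assms(3) by (simp add: sum_subtractf)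
    finally show ?thesis by simp
  qed simp
  have "0 = (\<Sum>k<n. b i)" using assms(1) eq by simp
  then show ?thesis using assms(3) by simp
qed

text \<open>Since the Cartan subalgebra acts diagonally, a nonzero coordinate \<open>s A\<close>
  forces the weight of \<open>A\<close> to agree with \<open>b\<close> as a linear form. Both
  coordinate sums being 0, \<open>cartan_separates\<close> upgrades this to equality of
  coordinates.\<close>

lemma spin_weight_space_eq:
  assumes "(\<Sum>i<p + q. b i) = 0"
  defines "F \<equiv> {A. A \<subseteq> pos_roots p q \<and> (\<forall>i<p + q. subset_weight p q A i = b i)}"
  shows "spin_weight_space p q b = {s. \<forall>A. A \<notin> F \<longrightarrow> s A = 0}"
proof -
  let ?n = "p + q"
  have action: "spin_action p q H s A = weight_eval ?n (subset_weight p q A) H * s A"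
    if "H \<in> cartan ?n" "A \<subseteq> pos_roots p q" for H s A
    by (simp only: spin_action_cartan[OF that(1)] weight_eval_def
        half_sum_pos_roots[OF that(2), of "\<lambda>i. H $$ (i, i)"])
  show ?thesis
  proof (intro equalityI subsetI; unfold mem_Collect_eq)
    fix s assume s: "s \<in> spin_weight_space p q b"
    show "\<forall>A. A \<notin> F \<longrightarrow> s A = 0"
    proof (intro allI impI, rule ccontr)
      fix A assume "A \<notin> F" "s A \<noteq> 0"
      then have A: "A \<subseteq> pos_roots p q"
        using s by (auto simp: spin_weight_space_def spinors_def)
      have "weight_eval ?n (\<lambda>i. subset_weight p q A i - b i) H = 0" if H: "H \<in> cartan ?n" for H
      proof -
        have "spin_action p q H s A = weight_eval ?n b H * s A"
          using s H by (simp add: spin_weight_space_def spinor_scale_def)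
        then have "weight_eval ?n (subset_weight p q A) H = weight_eval ?n b H"
          using \<open>s A \<noteq> 0\<close> by (simp add: action[OF H A])
        then show ?thesis by (simp add: weight_eval_def left_diff_distrib sum_subtractf)
      qed
      moreover have "(\<Sum>i<?n. subset_weight p q A i - b i) = 0"
        by (simp only: sum_subtractf sum_subset_weight[OF A] assms(1)) simp
      ultimately have "\<forall>i<?n. subset_weight p q A i - b i = 0"
        using cartan_separates by blast
      with \<open>A \<notin> F\<close> A show False by (auto simp: F_def)
    qed
  next
    fix s :: spinor assume s: "\<forall>A. A \<notin> F \<longrightarrow> s A = 0"
    \<comment> \<open>Outside \<open>F\<close> both sides vanish, because the action at
      \<open>A\<close> is a multiple of \<open>s A\<close>.\<close>
    have "spin_action p q H s A = weight_eval ?n b H * s A" if H: "H \<in> cartan ?n" for H A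
    proof (cases "A \<in> F")
      case True
      then have "weight_eval ?n (subset_weight p q A) H = weight_eval ?n b H"
        by (simp add: weight_eval_def F_def)
      then show ?thesis using True by (simp add: action[OF H] F_def)
    qed (simp add: s spin_action_cartan[OF H])
    then show "s \<in> spin_weight_space p q b"
      using s by (auto simp: spin_weight_space_def spinors_def spinor_scale_def F_def)
  qed
qed

lemma sum_spinors_apply: "(\<Sum>x\<in>S. f x :: spinor) A = (\<Sum>x\<in>S. f x A)"
  by (induction S rule: infinite_finite_induct) auto

lemma dim_supported_spinors:
  assumes "finite F"
  shows "vector_space.dim spinor_scale {s. \<forall>A. A \<notin> F \<longrightarrow> s A = 0} = card F"
proof -
  interpret vector_space spinor_scale by (rule vector_space_spinor_scale)
  define e :: "(nat \<times> nat) set \<Rightarrow> spinor" where "e A = (\<lambda>B. if B = A then 1 else 0)" for A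
  let ?V = "{s :: spinor. \<forall>A. A \<notin> F \<longrightarrow> s A = 0}"
  have inj: "inj_on e F"
    by (rule inj_onI) (metis e_def zero_neq_one)
  \<comment> \<open>This evaluation gives both the independence and the spanning property of the
    indicator functions \<open>e A\<close>.\<close>
  have expand: "(\<Sum>A\<in>F. spinor_scale (c A) (e A)) B = (if B \<in> F then c B else 0)" for c B
  proof -
    have "(\<Sum>A\<in>F. spinor_scale (c A) (e A)) B = (\<Sum>A\<in>F. if B = A then c A else 0)"
      unfolding sum_spinors_apply by (rule sum.cong) (auto simp: spinor_scale_def e_def)
    then show ?thesis using assms by simp
  qed
  have "independent (e ` F)"
  proof (rule independent_if_scalars_zero)
    fix f x assume 0: "(\<Sum>x\<in>e ` F. spinor_scale (f x) x) = 0" and "x \<in> e ` F"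
    then obtain A where A: "A \<in> F" "x = e A" by auto
    have "(\<Sum>A\<in>F. spinor_scale (f (e A)) (e A)) = 0" using 0 inj by (simp add: sum.reindex)
    then show "f x = 0" using expand[of "\<lambda>A. f (e A)" A] A by simp
  qed (use assms in simp)
  moreover have "?V \<subseteq> span (e ` F)"
  proof
    fix s assume "s \<in> ?V"
    then have "s = (\<Sum>A\<in>F. spinor_scale (s A) (e A))"
      by (auto simp: fun_eq_iff expand)
    also have "\<dots> \<in> span (e ` F)"
      by (intro span_sum span_scale span_base) auto
    finally show "s \<in> span (e ` F)" .
  qed
  moreover have "e ` F \<subseteq> ?V" by (auto simp: e_def)
  ultimately show ?thesis
    using basis_card_eq_dim[of "e ` F" ?V] card_image[OF inj] by simp
qed


section \<open>Row-tableaux and subsets with prescribed row and column sums\<close>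

text \<open>A strictly increasing row is recovered from its set of entries by sorting.\<close>

lemma nth_sorted_list_of_set_image:
  fixes g :: "nat \<Rightarrow> nat"
  assumes "strict_mono_on {..<m} g" "c < m"
  shows "sorted_list_of_set (g ` {..<m}) ! c = g c"
proof -
  have "sorted_wrt (<) (map g [0..<m])"
    using assms(1) by (auto simp: sorted_wrt_iff_nth_less strict_mono_on_def)
  then have "sorted_list_of_set (g ` {..<m}) = map g [0..<m]"
    by (intro strict_sorted_equal) (auto simp: atLeast0LessThan)
  then show ?thesis using assms(2) by simp
qed

definition row_increasing :: "nat list \<Rightarrow> (nat \<times> nat \<Rightarrow> nat) \<Rightarrow> bool" where
  "row_increasing \<alpha> T \<longleftrightarrow> (\<forall>r. strict_mono_on {..<part \<alpha> r} (\<lambda>c. T (r, c)))"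

lemma row_increasing_iff:
  "row_increasing \<alpha> T \<longleftrightarrow>
    (\<forall>r c c'. c < c' \<and> (r, c') \<in> young \<alpha> \<longrightarrow> T (r, c) < T (r, c'))"
  by (auto simp: row_increasing_def strict_mono_on_def young_def)

text \<open>The reversal \<open>k \<mapsto> N - k\<close> reflects the reversed order of the parts of \<open>\<beta>\<close> in \<open>mu\<close>.\<close>
definition tableau_set :: "nat \<Rightarrow> nat list \<Rightarrow> (nat \<times> nat \<Rightarrow> nat) \<Rightarrow> (nat \<times> nat) set" where
  "tableau_set N \<alpha> T = (\<lambda>(r, c). (r, N - T (r, c))) ` young \<alpha>"

text \<open>Inverse of \<open>tableau_set\<close>: each row is reversed back and sorted. The
  restriction to \<open>young \<alpha>\<close> makes the result extensional, as
  \<open>row_tableaux\<close> demands.\<close>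

definition set_tableau :: "nat \<Rightarrow> nat list \<Rightarrow> (nat \<times> nat) set \<Rightarrow> nat \<times> nat \<Rightarrow> nat" where
  "set_tableau N \<alpha> A = (\<lambda>(r, c)\<in>young \<alpha>. sorted_list_of_set ((\<lambda>j. N - j) ` {j. (r, j) \<in> A}) ! c)"

lemma tableau_set_row:
  "{j. (r, j) \<in> tableau_set N \<alpha> T} = (\<lambda>c. N - T (r, c)) ` {..<part \<alpha> r}"
  by (auto simp: tableau_set_def young_def)

text \<open>The bound by \<open>N\<close> matters: truncated subtraction from \<open>N\<close> is
  injective only on numbers up to \<open>N\<close>.\<close>

lemma card_tableau_set_row:
  assumes "row_increasing \<alpha> T" "\<And>x. x \<in> young \<alpha> \<Longrightarrow> T x \<le> N"
  shows "card {j. (r, j) \<in> tableau_set N \<alpha> T} = part \<alpha> r"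
proof -
  have inj: "inj_on (\<lambda>c. T (r, c)) {..<part \<alpha> r}"
    using assms(1) by (simp add: row_increasing_def strict_mono_on_imp_inj_on)
  have "inj_on (\<lambda>c. N - T (r, c)) {..<part \<alpha> r}"
  proof (rule inj_onI)
    fix c d assume cd: "c \<in> {..<part \<alpha> r}" "d \<in> {..<part \<alpha> r}" "N - T (r, c) = N - T (r, d)"
    then have "T (r, c) \<le> N" "T (r, d) \<le> N" by (auto intro!: assms(2) simp: young_def)
    with cd(3) have "T (r, c) = T (r, d)" by simp
    with inj show "c = d" using cd(1,2) by (rule inj_onD)
  qed
  then show ?thesis by (simp add: tableau_set_row card_image)
qed

text \<open>Strictly increasing rows contain \<open>k\<close> at most once, so a box with entry
  \<open>k\<close> is determined by its row.\<close>

lemma card_tableau_set_col: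
  assumes "row_increasing \<alpha> T" "\<And>x. x \<in> young \<alpha> \<Longrightarrow> T x \<le> N" "k \<le> N"
  shows "card {r. (r, N - k) \<in> tableau_set N \<alpha> T} = card {x \<in> young \<alpha>. T x = k}"
proof -
  have "inj_on fst {x \<in> young \<alpha>. T x = k}"
  proof (rule inj_onI)
    fix x y assume xy: "x \<in> {x \<in> young \<alpha>. T x = k}" "y \<in> {x \<in> young \<alpha>. T x = k}" "fst x = fst y"
    have "inj_on (\<lambda>c. T (fst x, c)) {..<part \<alpha> (fst x)}"
      using assms(1) by (simp add: row_increasing_def strict_mono_on_imp_inj_on)
    then have "snd x = snd y"
      using xy by (auto simp: inj_on_def young_def)
    with xy show "x = y" by (simp add: prod_eq_iff)
  qed
  moreover have "{r. (r, N - k) \<in> tableau_set N \<alpha> T} = fst ` {x \<in> young \<alpha>. T x = k}"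
  proof -
    have "N - k = N - T x \<longleftrightarrow> T x = k" if "x \<in> young \<alpha>" for x
      using assms(2)[OF that] assms(3) by auto
    then show ?thesis by (force simp: tableau_set_def image_iff)
  qed
  ultimately show ?thesis by (simp add: card_image)
qed

lemma set_tableau_tableau_set:
  assumes "row_increasing \<alpha> T" "\<And>x. x \<in> young \<alpha> \<Longrightarrow> T x \<le> N" "T \<in> extensional (young \<alpha>)"
  shows "set_tableau N \<alpha> (tableau_set N \<alpha> T) = T"
proof (rule extensionalityI[of _ "young \<alpha>"])
  fix x assume "x \<in> young \<alpha>"
  then obtain r c where x: "x = (r, c)" "c < part \<alpha> r" by (auto simp: young_def)
  have "(\<lambda>j. N - j) ` {j. (r, j) \<in> tableau_set N \<alpha> T} = (\<lambda>c. T (r, c)) ` {..<part \<alpha> r}"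
    unfolding tableau_set_row image_image
    by (rule image_cong) (use assms(2) in \<open>auto simp: young_def\<close>)
  then show "set_tableau N \<alpha> (tableau_set N \<alpha> T) x = T x"
    using x nth_sorted_list_of_set_image[of "part \<alpha> r" "\<lambda>c. T (r, c)" c] assms(1)
    by (simp add: set_tableau_def young_def row_increasing_def)
qed (use assms(3) in \<open>auto simp: set_tableau_def\<close>)

text \<open>All columns are at most \<open>N\<close>, so reversal is an involution on each row of
  \<open>A\<close>, and sorting lists exactly \<open>part \<alpha> r\<close> distinct
  entries.\<close>

lemma set_tableau_properties:
  assumes "A \<subseteq> UNIV \<times> {..N}" "\<And>r. card {j. (r, j) \<in> A} = part \<alpha> r"
  shows "row_increasing \<alpha> (set_tableau N \<alpha> A)"
    and "x \<in> young \<alpha> \<Longrightarrow> \<exists>j. (fst x, j) \<in> A \<and> set_tableau N \<alpha> A x = N - j"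
    and "tableau_set N \<alpha> (set_tableau N \<alpha> A) = A"
proof -
  \<comment> \<open>\<open>R r\<close> is the set of entries that row \<open>r\<close> of the
    tableau must have.\<close>
  define R where "R r = (\<lambda>j. N - j) ` {j. (r, j) \<in> A}" for r
  have fin: "finite {j. (r, j) \<in> A}" for r
    by (rule finite_subset[of _ "{..N}"]) (use assms(1) in auto)
  have "inj_on (\<lambda>j. N - j) {j. (r, j) \<in> A}" for r
    by (rule inj_on_subset[of _ "{..N}"]) (use assms(1) in \<open>auto simp: inj_on_def\<close>)
  then have cardR: "card (R r) = part \<alpha> r" for r
    by (simp add: R_def card_image assms(2))
  have T: "set_tableau N \<alpha> A (r, c) = sorted_list_of_set (R r) ! c" if "c < part \<alpha> r" for r c
    using that by (simp add: set_tableau_def R_def young_def)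
  have finR: "finite (R r)" for r using fin by (simp add: R_def)
  have R: "(\<lambda>c. set_tableau N \<alpha> A (r, c)) ` {..<part \<alpha> r} = R r" for r
  proof -
    have "(\<lambda>c. set_tableau N \<alpha> A (r, c)) ` {..<part \<alpha> r} = (!) (sorted_list_of_set (R r)) ` {..<part \<alpha> r}"
      by (rule image_cong) (auto simp: T)
    also have "\<dots> = set (sorted_list_of_set (R r))"
      by (auto simp: set_conv_nth image_iff cardR)
    finally show ?thesis using finR by simp
  qed
  show "row_increasing \<alpha> (set_tableau N \<alpha> A)"
    unfolding row_increasing_def strict_mono_on_def
    by (auto simp: T cardR intro!: sorted_wrt_nth_less[OF strict_sorted_list_of_set])
  show "\<exists>j. (fst x, j) \<in> A \<and> set_tableau N \<alpha> A x = N - j" if "x \<in> young \<alpha>"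
  proof -
    have "set_tableau N \<alpha> A (fst x, snd x) \<in> R (fst x)"
      using that unfolding R[symmetric] by (auto simp: young_def)
    then show ?thesis by (auto simp: R_def)
  qed
  have "{j. (r, j) \<in> tableau_set N \<alpha> (set_tableau N \<alpha> A)} = {j. (r, j) \<in> A}" for r
  proof -
    have "{j. (r, j) \<in> tableau_set N \<alpha> (set_tableau N \<alpha> A)} = (\<lambda>k. N - k) ` R r"
      unfolding tableau_set_row R[symmetric] image_image ..
    also have "\<dots> = (\<lambda>j. j) ` {j. (r, j) \<in> A}"
      unfolding R_def image_image by (rule image_cong) (use assms(1) in auto)
    finally show ?thesis by simp
  qed
  then show "tableau_set N \<alpha> (set_tableau N \<alpha> A) = A" by (auto simp: set_eq_iff)
qed

text \<open>With \<open>N = p + q\<close>, the entries 1 to \<open>q\<close> correspond to the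
  columns \<open>p + q - 1\<close> down to \<open>p\<close>, and the two encodings are mutually
  inverse.\<close>

lemma card_row_tableaux:
  assumes \<alpha>: "length \<alpha> = p" and \<beta>: "length \<beta> = q"
  shows "card (row_tableaux \<alpha> \<beta>) = card {A. A \<subseteq> pos_roots p q \<and>
    (\<forall>i<p. card {j. (i, j) \<in> A} = \<alpha> ! i) \<and>
    (\<forall>j\<in>{p..<p + q}. card {i. (i, j) \<in> A} = \<beta> ! (p + q - 1 - j))}"
    (is "_ = card ?F")
proof -
  let ?N = "p + q"
  have finY: "finite (young \<alpha>)"
  proof (rule finite_subset)
    show "young \<alpha> \<subseteq> (SIGMA r:{..<p}. {..<part \<alpha> r})"
      using \<alpha> by (auto simp: young_def part_def split: if_splits)
  qed simp
  have RT: "row_increasing \<alpha> T" "\<And>x. x \<in> young \<alpha> \<Longrightarrow> 1 \<le> T x \<and> T x \<le> q"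
    "T \<in> extensional (young \<alpha>)" "\<And>k. card {x \<in> young \<alpha>. T x = Suc k} = part \<beta> k"
    if T: "T \<in> row_tableaux \<alpha> \<beta>" for T
  proof -
    show "row_increasing \<alpha> T" "T \<in> extensional (young \<alpha>)"
      and cards: "\<And>k. card {x \<in> young \<alpha>. T x = Suc k} = part \<beta> k"
      using T by (auto simp: row_tableaux_def row_increasing_iff PiE_def)
    fix x assume x: "x \<in> young \<alpha>"
    have "T \<in> young \<alpha> \<rightarrow>\<^sub>E {1..}" using T by (simp add: row_tableaux_def)
    from PiE_mem[OF this x] have 1: "1 \<le> T x" by simp
    \<comment> \<open>The upper bound on entries comes from the weight: an entry that occurs has
      positive multiplicity, while \<open>part \<beta>\<close> is 0 from index \<open>q\<close> on.
      Finiteness of the diagram is needed because \<open>card\<close> is 0 on infinite sets.\<close>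
    have "x \<in> {y \<in> young \<alpha>. T y = Suc (T x - 1)}" using 1 x by simp
    then have "0 < card {y \<in> young \<alpha>. T y = Suc (T x - 1)}"
      unfolding card_gt_0_iff using finY by (intro conjI) (blast, simp)
    then have "0 < part \<beta> (T x - 1)" by (simp only: cards)
    then have "T x - 1 < q" using \<beta> by (auto simp: part_def split: if_splits)
    with 1 show "1 \<le> T x \<and> T x \<le> q" by auto
  qed
  have F: "\<And>r j. (r, j) \<in> A \<Longrightarrow> r < p \<and> p \<le> j \<and> j < ?N" "\<And>r. card {j. (r, j) \<in> A} = part \<alpha> r"
    if A: "A \<in> ?F" for A
  proof -
    show 1: "\<And>r j. (r, j) \<in> A \<Longrightarrow> r < p \<and> p \<le> j \<and> j < ?N"
      using A by (auto simp: pos_roots_def)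
    \<comment> \<open>Rows from \<open>p\<close> on are empty, matching the default value 0 of
      \<open>part\<close>.\<close>
    have "{j. (r, j) \<in> A} = {}" if "\<not> r < p" for r
      using 1 that by auto
    then show "card {j. (r, j) \<in> A} = part \<alpha> r" for r
      using A \<alpha> by (cases "r < p") (auto simp: part_def)
  qed
  have "bij_betw (tableau_set ?N \<alpha>) (row_tableaux \<alpha> \<beta>) ?F"
  proof (rule bij_betwI[where g = "set_tableau ?N \<alpha>"])
    show "tableau_set ?N \<alpha> \<in> row_tableaux \<alpha> \<beta> \<rightarrow> ?F"
    proof
      fix T assume T: "T \<in> row_tableaux \<alpha> \<beta>"
      note T' = RT[OF T]
      have le: "T x \<le> ?N" if "x \<in> young \<alpha>" for x using T'(2)[OF that] by simp
      have "tableau_set ?N \<alpha> T \<subseteq> pos_roots p q"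
      proof
        fix a assume "a \<in> tableau_set ?N \<alpha> T"
        then obtain r c where a: "a = (r, ?N - T (r, c))" "(r, c) \<in> young \<alpha>"
          by (auto simp: tableau_set_def)
        then have "r < p" using \<alpha> by (auto simp: young_def part_def split: if_splits)
        with a T'(2)[OF a(2)] show "a \<in> pos_roots p q" by (auto simp: pos_roots_def)
      qed
      moreover have "card {j. (i, j) \<in> tableau_set ?N \<alpha> T} = \<alpha> ! i" if "i < p" for i
        using card_tableau_set_row[OF T'(1) le] that \<alpha> by (simp add: part_def)
      moreover have "card {i. (i, j) \<in> tableau_set ?N \<alpha> T} = \<beta> ! (?N - 1 - j)"
        if "j \<in> {p..<?N}" for j
      proof -
        \<comment> \<open>Column \<open>j\<close> carries the entry \<open>?N - j\<close>, whose
          multiplicity is stored at index \<open>?N - 1 - j\<close>.\<close>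
        have j: "?N - (?N - j) = j" "?N - j = Suc (?N - 1 - j)" "?N - 1 - j < q" using that by auto
        show ?thesis
          using card_tableau_set_col[OF T'(1) le, of "?N - j"] T'(4)[of "?N - 1 - j"] j \<beta>
          by (simp add: part_def)
      qed
      ultimately show "tableau_set ?N \<alpha> T \<in> ?F" by blast
    qed
    show "set_tableau ?N \<alpha> \<in> ?F \<rightarrow> row_tableaux \<alpha> \<beta>"
    proof
      fix A assume A: "A \<in> ?F"
      let ?T = "set_tableau ?N \<alpha> A"
      have "A \<subseteq> UNIV \<times> {..?N}" using F(1)[OF A] by (auto intro: less_imp_le)
      note T = set_tableau_properties[OF this F(2)[OF A]]
      have range: "1 \<le> ?T x \<and> ?T x \<le> q" if "x \<in> young \<alpha>" for x
        using T(2)[OF that] F(1)[OF A] by fastforce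
      have le: "?T x \<le> ?N" if "x \<in> young \<alpha>" for x using range[OF that] by simp
      have "card {x \<in> young \<alpha>. ?T x = Suc k} = part \<beta> k" for k
      proof (cases "k < q")
        case True
        then have "card {x \<in> young \<alpha>. ?T x = Suc k} = card {r. (r, ?N - Suc k) \<in> A}"
          using card_tableau_set_col[OF T(1) le, of "Suc k"] T(3) by simp
        moreover have "?N - Suc k \<in> {p..<?N}" "?N - 1 - (?N - Suc k) = k" using True by auto
        ultimately show ?thesis using A \<beta> True by (auto simp: part_def)
      next
        case False
        \<comment> \<open>No entry exceeds \<open>q\<close>, again matching the default value 0 of
          \<open>part\<close>.\<close>
        then have "{x \<in> young \<alpha>. ?T x = Suc k} = {}" using range by fastforce
        then have "card {x \<in> young \<alpha>. ?T x = Suc k} = 0" by (simp only: card.empty)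
        then show ?thesis using False \<beta> by (simp add: part_def)
      qed
      moreover have "?T \<in> young \<alpha> \<rightarrow>\<^sub>E {1..}"
        using range by (auto simp: PiE_def set_tableau_def)
      ultimately show "?T \<in> row_tableaux \<alpha> \<beta>"
        using T(1) by (auto simp: row_tableaux_def row_increasing_iff)
    qed
    show "set_tableau ?N \<alpha> (tableau_set ?N \<alpha> T) = T" if T: "T \<in> row_tableaux \<alpha> \<beta>" for T
      using RT[OF T] by (intro set_tableau_tableau_set) (auto intro: trans_le_add2)
    show "tableau_set ?N \<alpha> (set_tableau ?N \<alpha> A) = A" if A: "A \<in> ?F" for A
      by (rule set_tableau_properties(3)) (use F[OF A] in \<open>auto intro: less_imp_le\<close>)
  qed
  then show ?thesis by (rule bij_betw_same_card)
qed

section \<open>Comparison with the weight \<open>mu\<close> and the multiplicity formula\<close>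

lemma sum_mu:
  assumes "length \<alpha> = p" "length \<beta> = q" "sum_list \<alpha> = sum_list \<beta>"
  shows "(\<Sum>i<p + q. mu p q \<alpha> \<beta> i) = 0"
proof -
  \<comment> \<open>Reversing the index undoes the reversal of \<beta>. The two blocks then
    contribute m - pq/2 and pq/2 - m, where m is the common sum.\<close>
  have "(\<Sum>i\<in>{p..<p + q}. of_nat (\<beta> ! (p + q - 1 - i)) :: complex) = (\<Sum>i<q. of_nat (\<beta> ! i))"
    by (rule sum.reindex_bij_witness[of _ "\<lambda>i. p + q - 1 - i" "\<lambda>i. p + q - 1 - i"]) auto
  also have "\<dots> = of_nat (sum_list \<alpha>)"
    using assms by (simp add: sum_list_sum_nth atLeast0LessThan)
  finally have \<beta>: "(\<Sum>i\<in>{p..<p + q}. of_nat (\<beta> ! (p + q - 1 - i)) :: complex) = of_nat (sum_list \<alpha>)" .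
  have \<alpha>: "(\<Sum>i<p. of_nat (\<alpha> ! i) :: complex) = of_nat (sum_list \<alpha>)"
    using assms(1) by (simp add: sum_list_sum_nth atLeast0LessThan)
  have "(\<Sum>i<p. mu p q \<alpha> \<beta> i) = (\<Sum>i<p. of_nat (\<alpha> ! i) - of_nat q / 2)"
    by (rule sum.cong) (auto simp: mu_def)
  moreover have "(\<Sum>i\<in>{p..<p + q}. mu p q \<alpha> \<beta> i) =
      (\<Sum>i\<in>{p..<p + q}. of_nat p / 2 - of_nat (\<beta> ! (p + q - 1 - i)))"
    by (rule sum.cong) (auto simp: mu_def)
  ultimately show ?thesis
    unfolding sum_lessThan_add sum_subtractf \<alpha> \<beta> by simp
qed

theorem theoremD:
  fixes p q :: nat and \<alpha> \<beta> :: "nat list"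
  assumes "p \<ge> 1" and "q \<ge> 1"
    and "(\<alpha>, \<beta>) \<in> PP' p q"
  shows "spin_mult p q (mu p q \<alpha> \<beta>) = card (row_tableaux \<alpha> \<beta>)"
proof -
  have len: "length \<alpha> = p" "length \<beta> = q" and sum: "sum_list \<alpha> = sum_list \<beta>"
    using assms(3) by (auto simp: PP'_def PP_def partition_of_def)
  let ?F = "{A. A \<subseteq> pos_roots p q \<and> (\<forall>i<p + q. subset_weight p q A i = mu p q \<alpha> \<beta> i)}"
  have "finite ?F" by (rule finite_subset[of _ "Pow (pos_roots p q)"]) auto
  then have "spin_mult p q (mu p q \<alpha> \<beta>) = card ?F"
    by (simp only: spin_mult_def spin_weight_space_eq[OF sum_mu[OF len sum]] dim_supported_spinors)
  \<comment> \<open>The shifts by q/2 and p/2 are the same in both weights, so equality of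
    coordinates is equality of row and column counts.\<close>
  also have "(\<forall>i<p + q. subset_weight p q A i = mu p q \<alpha> \<beta> i) \<longleftrightarrow>
      (\<forall>i<p. card {j. (i, j) \<in> A} = \<alpha> ! i) \<and>
      (\<forall>j\<in>{p..<p + q}. card {i. (i, j) \<in> A} = \<beta> ! (p + q - 1 - j))" for A
  proof -
    have "(\<forall>i<p + q. P i) \<longleftrightarrow> (\<forall>i<p. P i) \<and> (\<forall>i\<in>{p..<p + q}. P i)" for P
      by (metis atLeastLessThan_iff not_le trans_less_add1)
    then show ?thesis by (simp add: subset_weight_def mu_def)
  qed
  then have "card ?F = card (row_tableaux \<alpha> \<beta>)"
    by (simp only: card_row_tableaux[OF len])
  finally show ?thesis .
qed

end
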